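(* Let $(T_i,X_i,Y_i)$, $i=1,2,\ldots$, be i.i.d. copies of $(T,X,Y)$ with $Y=TY(1)+(1-T)Y(0)$. Assume: (i) $Y(t)$ is conditionally independent of $T$ given $X$, for $t=0,1$; (ii) there is $\eta>0$ with $\eta<e(X)<1-\eta$ almost surely, where $e(X)=P(T=1\mid X)$; (iii) $\hat\beta^*\stackrel{p}{\longrightarrow}\beta^*$ as $n\to\infty$; (iv) there is $\nu>0$ with $\nu<e^*(X)<1-\nu$ almost surely, where $e^*(X)=e^{\mathrm{mis}}(X,\beta^* )$; (v) the weak law of large numbers with estimated parameter holds for the summands of the estimator, in the sense specified in the context. Let $$\hat\Delta^*_{\mathrm{IPW}_2}=\left(\sum_{i=1}^n\frac{T_i}{\hat e^*(X_i)}\right)^{-1}\sum_{i=1}^n\frac{T_iY_i}{\hat e^*(X_i)}-\left(\sum_{i=1}^n\frac{1-T_i}{1-\hat e^*(X_i)}\right)^{-1}\sum_{i=1}^n\frac{(1-T_i)Y_i}{1-\hat e^*(X_i)},$$ where $\hat e^*(X_i)=e^{\mathrm{mis}}(X_i,\hat\beta^* )$. Then, as $n\to\infty$, $$\hat\Delta^*_{\mathrm{IPW}_2}-\Delta\stackrel{p}{\longrightarrow}\frac{E\left[\frac{e(X)}{e^*(X)}\mu_1(X)\right]}{E\left[\frac{e(X)}{e^*(X)}\right]}-\frac{E\left[\frac{1-e(X)}{1-e^*(X)}\mu_0(X)\right]}{E\left[\frac{1-e(X)}{1-e^*(X)}\right]}-(\mu_1-\mu_0).$$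
   Context: $X$ is a random vector of covariates, $T\in\{0,1\}$ a binary treatment, and $Y(1),Y(0)$ are integrable real-valued potential outcomes. Notation: $\mu_t=E[Y(t)]$, $\mu_t(X)=E(Y(t)\mid X)$, $t=0,1$, and $\Delta=\mu_1-\mu_0$ (the average causal effect). $e^{\mathrm{mis}}(x,\beta)$ is a parametric working model (with values in $(0,1)$) for the propensity score $e(X)$, which need not be correctly specified, i.e. $e^*(X)=e^{\mathrm{mis}}(X,\beta^* )$ need not equal $e(X)$. $\hat\beta^*=\hat\beta^*_n$ is an estimator computed from $(T_i,X_i,Y_i)_{i\le n}$, and $\beta^*$ is a fixed parameter value. The estimator $\hat\Delta^*_{\mathrm{IPW}_2}$ is set to an arbitrary value when one of its normalizing sums is zero. Regularity assumption (v) (weak law of large numbers with estimated parameter): for each of the functions $g(T,X,Y,\beta)=\frac{TY}{e^{\mathrm{mis}}(X,\beta)}$, $\frac{T}{e^{\mathrm{mis}}(X,\beta)}$, $\frac{(1-T)Y}{1-e^{\mathrm{mis}}(X,\beta)}$, $\frac{1-T}{1-e^{\mathrm{mis}}(X,\beta)}$ one has $\frac1n\sum_{i=1}^n g(T_i,X_i,Y_i,\hat\beta^* )\stackrel{p}{\longrightarrow}E[g(T,X,Y,\beta^* )]$. *)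

theory Defs
  imports "HOL-Probability.Probability"
begin

text \<open>
  Convergence in probability to a constant. It includes the requirement that every \<open>Z n\<close> be a random
  variable, since \<open>measure\<close> is 0 on non-measurable sets.
\<close>

definition conv_in_prob ::
    "'a measure \<Rightarrow> (nat \<Rightarrow> 'a \<Rightarrow> 'b::{metric_space, second_countable_topology}) \<Rightarrow> 'b \<Rightarrow> bool" where
  "conv_in_prob M Z c \<longleftrightarrow>
     (\<forall>n. Z n \<in> borel_measurable M) \<and>
     (\<forall>\<epsilon>>0. (\<lambda>n. measure M {\<omega> \<in> space M. dist (Z n \<omega>) c > \<epsilon>}) \<longlonglongrightarrow> 0)"

definition sigma_rv :: "'a measure \<Rightarrow> ('a \<Rightarrow> 'x::topological_space) \<Rightarrow> 'a measure" where
  "sigma_rv M X = vimage_algebra (space M) X borel"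

definition cond_mean :: "'a measure \<Rightarrow> ('a \<Rightarrow> 'x::topological_space) \<Rightarrow> ('a \<Rightarrow> real) \<Rightarrow> 'a \<Rightarrow> real" where
  "cond_mean M X Z = real_cond_exp M (sigma_rv M X) Z"

definition cond_prob_rv :: "'a measure \<Rightarrow> ('a \<Rightarrow> 'x::topological_space) \<Rightarrow> 'a set \<Rightarrow> 'a \<Rightarrow> real" where
  "cond_prob_rv M X E = cond_mean M X (indicator E)"

definition cond_indep ::
    "'a measure \<Rightarrow> ('a \<Rightarrow> 'y::topological_space) \<Rightarrow> ('a \<Rightarrow> 't::topological_space)
      \<Rightarrow> ('a \<Rightarrow> 'x::topological_space) \<Rightarrow> bool" where
  "cond_indep M Y T X \<longleftrightarrow>
     (\<forall>A\<in>sets borel. \<forall>B\<in>sets borel. AE \<omega> in M.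
        cond_prob_rv M X {\<omega>' \<in> space M. Y \<omega>' \<in> A \<and> T \<omega>' \<in> B} \<omega> =
        cond_prob_rv M X {\<omega>' \<in> space M. Y \<omega>' \<in> A} \<omega> * cond_prob_rv M X {\<omega>' \<in> space M. T \<omega>' \<in> B} \<omega>)"

text \<open>The random variable \<open>e(X) = P(T = 1 | X)\<close>.\<close>

definition propensity :: "'a measure \<Rightarrow> ('a \<Rightarrow> real) \<Rightarrow> ('a \<Rightarrow> 'x::topological_space) \<Rightarrow> 'a \<Rightarrow> real" where
  "propensity M T X = cond_prob_rv M X {\<omega> \<in> space M. T \<omega> = 1}"

definition iid_copies ::
    "'a measure \<Rightarrow> (nat \<Rightarrow> 'a \<Rightarrow> 'w::topological_space) \<Rightarrow> ('a \<Rightarrow> 'w) \<Rightarrow> bool" where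
  "iid_copies M Ws W \<longleftrightarrow>
     prob_space.indep_vars M (\<lambda>_. borel) Ws {1..} \<and> (\<forall>i\<ge>1. distr M borel (Ws i) = distr M borel W)"

text \<open>
  \<open>bh n\<close> is an estimator computed from the observations \<open>W\<^sub>1, \<dots>, W\<^sub>n\<close>: a Borel function of them,
  with values in the parameter set \<open>\<Theta>\<close>.
\<close>

definition is_estimator ::
    "'a measure \<Rightarrow> (nat \<Rightarrow> 'a \<Rightarrow> 'w::topological_space) \<Rightarrow> 'b::topological_space set
      \<Rightarrow> (nat \<Rightarrow> 'a \<Rightarrow> 'b) \<Rightarrow> bool" where
  "is_estimator M Ws \<Theta> bh \<longleftrightarrow>
     (\<forall>n. \<exists>h \<in> borel_measurable (PiM {1..n} (\<lambda>_. borel)).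
        \<forall>\<omega>\<in>space M. bh n \<omega> = h (\<lambda>i\<in>{1..n}. Ws i \<omega>) \<and> bh n \<omega> \<in> \<Theta>)"

definition wlln_estimated ::
    "'a measure \<Rightarrow> (nat \<Rightarrow> 'a \<Rightarrow> 'w) \<Rightarrow> ('a \<Rightarrow> 'w) \<Rightarrow> (nat \<Rightarrow> 'a \<Rightarrow> 'b) \<Rightarrow> 'b
      \<Rightarrow> ('w \<Rightarrow> 'b \<Rightarrow> real) \<Rightarrow> bool" where
  "wlln_estimated M Ws W bh b g \<longleftrightarrow>
     conv_in_prob M (\<lambda>n \<omega>. 1 / real n * (\<Sum>i=1..n. g (Ws i \<omega>) (bh n \<omega>)))
       (\<integral>\<omega>. g (W \<omega>) b \<partial>M)"

text \<open>\<open>c\<close> is the value given to the estimator when a normalizing sum vanishes.\<close>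

definition ipw2 ::
    "('x \<Rightarrow> 'b \<Rightarrow> real) \<Rightarrow> real \<Rightarrow> 'b \<Rightarrow> nat \<Rightarrow> (nat \<Rightarrow> real) \<Rightarrow> (nat \<Rightarrow> 'x) \<Rightarrow> (nat \<Rightarrow> real) \<Rightarrow> real" where
  "ipw2 emis c b n t x y =
     (let S1 = (\<Sum>i=1..n. t i / emis (x i) b);
          S0 = (\<Sum>i=1..n. (1 - t i) / (1 - emis (x i) b))
      in if S1 = 0 \<or> S0 = 0 then c
         else inverse S1 * (\<Sum>i=1..n. t i * y i / emis (x i) b)
            - inverse S0 * (\<Sum>i=1..n. (1 - t i) * y i / (1 - emis (x i) b)))"

end

theory Submission
  imports Defs
begin

text \<open>
  After division by \<open>n\<close>, assumption (v) makes each normalized sum of the estimator converge in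
  probability, so the continuous mapping theorem gives the limit
  \<open>E[T Y / e*] / E[T / e*] - E[(1 - T) Y / (1 - e*)] / E[(1 - T) / (1 - e*)]\<close>. Replacing \<open>T Y\<close> by \<open>e(X) \<mu>\<^sub>1(X)\<close>
  is the content of conditional independence: the finite measures
  \<open>A \<mapsto> E[w 1{T = 1} 1{Y(1) \<in> A}]\<close> and \<open>A \<mapsto> E[w e(X) 1{Y(1) \<in> A}]\<close> agree for every nonnegative bounded
  \<open>w\<close> depending on \<open>X\<close> only, hence so do their first moments.
\<close>

section \<open>Convergence in probability to a constant\<close>

lemma conv_in_probD:
  assumes "conv_in_prob M Z c" "\<epsilon> > 0"
  shows "(\<lambda>n. measure M {\<omega> \<in> space M. dist (Z n \<omega>) c > \<epsilon>}) \<longlonglongrightarrow> 0"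
  using assms by (simp add: conv_in_prob_def)

text \<open>The product distance is at most the sum of the coordinate distances, so a deviation
  beyond \<epsilon> forces one coordinate to deviate by more than \<epsilon>/2. A union bound then
  gives the limit.\<close>

lemma conv_in_prob_Pair:
  fixes U :: "nat \<Rightarrow> 'a \<Rightarrow> 'b::{metric_space, second_countable_topology}"
    and V :: "nat \<Rightarrow> 'a \<Rightarrow> 'c::{metric_space, second_countable_topology}"
  assumes "prob_space M" and U: "conv_in_prob M U u" and V: "conv_in_prob M V v"
  shows "conv_in_prob M (\<lambda>n \<omega>. (U n \<omega>, V n \<omega>)) (u, v)"
  unfolding conv_in_prob_def
proof (intro conjI allI impI)
  interpret prob_space M by fact
  have [measurable]: "U n \<in> borel_measurable M" "V n \<in> borel_measurable M" for n
    using U V by (auto simp: conv_in_prob_def)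
  show "(\<lambda>\<omega>. (U n \<omega>, V n \<omega>)) \<in> borel_measurable M" for n
    by measurable
  fix \<epsilon> :: real assume "\<epsilon> > 0"
  let ?P = "\<lambda>n. {\<omega> \<in> space M. dist (U n \<omega>) u > \<epsilon> / 2}"
  let ?Q = "\<lambda>n. {\<omega> \<in> space M. dist (V n \<omega>) v > \<epsilon> / 2}"
  have lim: "(\<lambda>n. prob (?P n) + prob (?Q n)) \<longlonglongrightarrow> 0 + 0"
    using \<open>\<epsilon> > 0\<close> by (intro tendsto_add conv_in_probD[OF U] conv_in_probD[OF V] half_gt_zero)
  have le: "prob {\<omega> \<in> space M. dist (U n \<omega>, V n \<omega>) (u, v) > \<epsilon>} \<le> prob (?P n) + prob (?Q n)" for n
  proof -
    have "dist (a, b) (u, v) \<le> dist a u + dist b v" for a b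
      by (simp add: dist_Pair_Pair sqrt_sum_squares_le_sum)
    then have "dist a u > \<epsilon> / 2 \<or> dist b v > \<epsilon> / 2" if "dist (a, b) (u, v) > \<epsilon>" for a b
      using that by (smt (verit) field_sum_of_halves)
    then have "{\<omega> \<in> space M. dist (U n \<omega>, V n \<omega>) (u, v) > \<epsilon>} \<subseteq> ?P n \<union> ?Q n"
      by blast
    then have "prob {\<omega> \<in> space M. dist (U n \<omega>, V n \<omega>) (u, v) > \<epsilon>} \<le> prob (?P n \<union> ?Q n)"
      by (rule finite_measure_mono) measurable
    also have "\<dots> \<le> prob (?P n) + prob (?Q n)"
      by (rule measure_Un_le) measurable
    finally show ?thesis .
  qed
  show "(\<lambda>n. prob {\<omega> \<in> space M. dist (U n \<omega>, V n \<omega>) (u, v) > \<epsilon>}) \<longlonglongrightarrow> 0"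
    by (rule tendsto_sandwich[OF _ always_eventually tendsto_const lim[unfolded add_0]])
      (use le in simp_all)
qed

text \<open>The set \<open>D\<close> accommodates estimators that take an arbitrary value where a normalizing sum vanishes.\<close>

lemma conv_in_prob_continuous:
  fixes Z :: "nat \<Rightarrow> 'a \<Rightarrow> 'b::{metric_space, second_countable_topology}"
    and R :: "nat \<Rightarrow> 'a \<Rightarrow> 'c::{metric_space, second_countable_topology}"
  assumes "prob_space M" and Z: "conv_in_prob M Z z" and f: "isCont f z"
    and D: "open D" "z \<in> D"
    and R: "\<And>n. R n \<in> borel_measurable M"
    and R_eq: "eventually (\<lambda>n. \<forall>\<omega>\<in>space M. Z n \<omega> \<in> D \<longrightarrow> R n \<omega> = f (Z n \<omega>)) sequentially"
  shows "conv_in_prob M R (f z)"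
  unfolding conv_in_prob_def
proof (intro conjI allI impI)
  interpret prob_space M by fact
  have [measurable]: "Z n \<in> borel_measurable M" for n
    using Z by (auto simp: conv_in_prob_def)
  show "R n \<in> borel_measurable M" for n by (rule R)
  fix \<epsilon> :: real assume "\<epsilon> > 0"
  \<comment> \<open>Continuity of \<open>f\<close> and openness of \<open>D\<close> are merged into
    one radius \<delta>: inside it \<open>R n\<close> coincides with \<open>f (Z n)\<close> and lies
    within \<epsilon> of the limit.\<close>
  have "eventually (\<lambda>a. dist (f a) (f z) < \<epsilon> \<and> a \<in> D) (nhds z)"
    using f D \<open>\<epsilon> > 0\<close> unfolding isCont_def tendsto_at_iff_tendsto_nhds
    by (intro eventually_conj tendstoD eventually_nhds_in_open)
  then obtain \<delta> where "\<delta> > 0" and \<delta>: "\<And>a. dist a z < \<delta> \<Longrightarrow> dist (f a) (f z) < \<epsilon> \<and> a \<in> D"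
    unfolding eventually_nhds_metric by blast
  have "eventually (\<lambda>n. prob {\<omega> \<in> space M. dist (R n \<omega>) (f z) > \<epsilon>}
      \<le> prob {\<omega> \<in> space M. dist (Z n \<omega>) z > \<delta> / 2}) sequentially"
    using R_eq
  proof eventually_elim
    case (elim n)
    \<comment> \<open>The argument yields only a distance of at least \<delta>. Halving restores the
      strict inequality used in \<open>conv_in_prob\<close>.\<close>
    have "dist (Z n \<omega>) z > \<delta> / 2" if "\<omega> \<in> space M" "dist (R n \<omega>) (f z) > \<epsilon>" for \<omega>
      using \<delta>[of "Z n \<omega>"] elim that \<open>\<delta> > 0\<close> by (cases "dist (Z n \<omega>) z < \<delta>") auto
    then show ?case
      by (intro finite_measure_mono) (auto intro!: measurable_sets)
  qed
  from tendsto_sandwich[OF _ this tendsto_const conv_in_probD[OF Z half_gt_zero[OF \<open>\<delta> > 0\<close>]]]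
  show "(\<lambda>n. prob {\<omega> \<in> space M. dist (R n \<omega>) (f z) > \<epsilon>}) \<longlonglongrightarrow> 0"
    by simp
qed

section \<open>Conditional independence under a weight\<close>

lemma subalgebra_sigma_rv:
  assumes "X \<in> borel_measurable M"
  shows "subalgebra M (sigma_rv M X)"
  unfolding subalgebra_def sigma_rv_def
  using sets_image_in_sets[OF refl assms] by simp

lemma sigma_finite_subalgebra_sigma_rv:
  assumes "prob_space M" and "X \<in> borel_measurable M"
  shows "sigma_finite_subalgebra M (sigma_rv M X)"
proof -
  interpret prob_space M by fact
  interpret finite_measure_subalgebra M "sigma_rv M X"
    by unfold_locales (rule subalgebra_sigma_rv[OF assms(2)])
  show ?thesis by unfold_locales
qed

lemma measurable_sigma_rv:
  assumes "g \<in> borel_measurable borel"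
  shows "(\<lambda>\<omega>. g (X \<omega>)) \<in> borel_measurable (sigma_rv M X)"
proof -
  have "X \<in> measurable (sigma_rv M X) borel"
    unfolding sigma_rv_def by (rule measurable_vimage_algebra1) simp
  then show ?thesis using assms by (rule measurable_compose)
qed

text \<open>The measures with densities \<open>f\<close> and \<open>g\<close> have the same image
  under \<open>Z\<close> by \<open>eq\<close>, and each side is the integral of the identity against
  that image. If this first moment does not exist, both sides have the default value 0.\<close>

lemma integral_weighted_cong:
  fixes f g Z :: "'a \<Rightarrow> real"
  assumes f: "integrable M f" "AE \<omega> in M. 0 \<le> f \<omega>" and g: "integrable M g" "AE \<omega> in M. 0 \<le> g \<omega>"
    and Z[measurable]: "Z \<in> borel_measurable M"
    and eq: "\<And>A. A \<in> sets borel \<Longrightarrow>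
      (\<integral>\<omega>. f \<omega> * indicator {\<omega> \<in> space M. Z \<omega> \<in> A} \<omega> \<partial>M) =
      (\<integral>\<omega>. g \<omega> * indicator {\<omega> \<in> space M. Z \<omega> \<in> A} \<omega> \<partial>M)"
  shows "(\<integral>\<omega>. f \<omega> * Z \<omega> \<partial>M) = (\<integral>\<omega>. g \<omega> * Z \<omega> \<partial>M)"
proof -
  have [measurable]: "f \<in> borel_measurable M" "g \<in> borel_measurable M"
    using f g by auto
  \<comment> \<open>\<open>density\<close> coerces \<open>h\<close> to \<open>ennreal\<close>, which
    sends negative values to 0. Nonnegativity almost everywhere is what turns the result back into
    the real integral appearing in \<open>eq\<close>.\<close>
  have emeas: "emeasure (distr (density M h) borel Z) A =
      ennreal (\<integral>\<omega>. h \<omega> * indicator {\<omega> \<in> space M. Z \<omega> \<in> A} \<omega> \<partial>M)"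
    if h: "integrable M h" "AE \<omega> in M. 0 \<le> h \<omega>" and [measurable]: "A \<in> sets borel"
    for h :: "'a \<Rightarrow> real" and A
  proof -
    have [measurable]: "h \<in> borel_measurable M" using h by auto
    have "emeasure (distr (density M h) borel Z) A =
        (\<integral>\<^sup>+\<omega>. ennreal (h \<omega>) * indicator {\<omega> \<in> space M. Z \<omega> \<in> A} \<omega> \<partial>M)"
      by (simp add: emeasure_distr emeasure_density vimage_def Int_def conj_commute)
    also have "\<dots> = (\<integral>\<^sup>+\<omega>. ennreal (h \<omega> * indicator {\<omega> \<in> space M. Z \<omega> \<in> A} \<omega>) \<partial>M)"
      by (intro nn_integral_cong) (auto split: split_indicator)
    also have "\<dots> = ennreal (\<integral>\<omega>. h \<omega> * indicator {\<omega> \<in> space M. Z \<omega> \<in> A} \<omega> \<partial>M)"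
      using h by (intro nn_integral_eq_integral integrable_real_mult_indicator) auto
    finally show ?thesis .
  qed
  have "distr (density M f) borel Z = distr (density M g) borel Z"
    by (rule measure_eqI) (use f g eq in \<open>auto simp: emeas\<close>)
  moreover have "(\<integral>\<omega>. h \<omega> * Z \<omega> \<partial>M) = (\<integral>y. y \<partial>distr (density M h) borel Z)"
    if h: "integrable M h" "AE \<omega> in M. 0 \<le> h \<omega>" for h
  proof -
    have "(\<integral>y. y \<partial>distr (density M h) borel Z) = (\<integral>\<omega>. Z \<omega> \<partial>density M h)"
      by (rule integral_distr) auto
    also have "\<dots> = (\<integral>\<omega>. h \<omega> * Z \<omega> \<partial>M)"
      using h by (subst integral_density) auto
    finally show ?thesis ..
  qed
  ultimately show ?thesis
    using f g by (metis (no_types))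
qed

lemma cond_prob_rv_bounds:
  assumes "prob_space M" and "X \<in> borel_measurable M" and "E \<in> sets M"
  shows "AE \<omega> in M. 0 \<le> cond_prob_rv M X E \<omega> \<and> cond_prob_rv M X E \<omega> \<le> 1"
proof -
  interpret prob_space M by fact
  interpret sigma_finite_subalgebra M "sigma_rv M X"
    using assms by (intro sigma_finite_subalgebra_sigma_rv)
  have "integrable M (indicator E :: 'a \<Rightarrow> real)"
    using assms by (simp add: integrable_indicator_iff emeasure_eq_measure)
  then show ?thesis
    unfolding cond_prob_rv_def cond_mean_def
    by (intro AE_conjI real_cond_exp_ge_c real_cond_exp_le_c) auto
qed

text \<open>This is the defining property of conditional expectation with test function
  \<open>w\<close>. It serves to pass from an indicator to its conditional probability and
  back.\<close>

lemma integral_cond_prob_rv: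
  fixes w :: "'a \<Rightarrow> real"
  assumes "prob_space M" and "X \<in> borel_measurable M" and "E \<in> sets M"
    and "w \<in> borel_measurable (sigma_rv M X)" and "integrable M w"
  shows "(\<integral>\<omega>. w \<omega> * cond_prob_rv M X E \<omega> \<partial>M) = (\<integral>\<omega>. w \<omega> * indicator E \<omega> \<partial>M)"
proof -
  interpret prob_space M by fact
  interpret sigma_finite_subalgebra M "sigma_rv M X"
    using assms by (intro sigma_finite_subalgebra_sigma_rv)
  show ?thesis
    unfolding cond_prob_rv_def cond_mean_def
    using assms by (intro real_cond_exp_intg integrable_real_mult_indicator) auto
qed

text \<open>\<open>cond_indep\<close> speaks of events only, whereas \<open>Z\<close> may be
  unbounded. The factorization is therefore applied to the events \<open>Z \<in> A\<close> and
  carried over to the first moment by \<open>integral_weighted_cong\<close>; a final conditioning on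
  \<open>X\<close> replaces \<open>Z\<close> by its conditional mean.\<close>

lemma integral_weighted_cond_indep:
  fixes Z T w :: "'a \<Rightarrow> real"
  assumes "prob_space M" and X: "X \<in> borel_measurable M"
    and T[measurable]: "T \<in> borel_measurable M" and Z: "integrable M Z"
    and indep: "cond_indep M Z T X" and B[measurable]: "B \<in> sets borel"
    and w: "w \<in> borel_measurable (sigma_rv M X)" "AE \<omega> in M. 0 \<le> w \<omega> \<and> w \<omega> \<le> K"
  shows "(\<integral>\<omega>. w \<omega> * indicator {\<omega> \<in> space M. T \<omega> \<in> B} \<omega> * Z \<omega> \<partial>M) =
    (\<integral>\<omega>. w \<omega> * cond_prob_rv M X {\<omega> \<in> space M. T \<omega> \<in> B} \<omega> * cond_mean M X Z \<omega> \<partial>M)"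
proof -
  interpret prob_space M by fact
  let ?F = "sigma_rv M X"
  interpret sigma_finite_subalgebra M ?F
    using assms by (intro sigma_finite_subalgebra_sigma_rv)
  define E where "E = {\<omega> \<in> space M. T \<omega> \<in> B}"
  define q where "q = cond_prob_rv M X E"
  have [measurable]: "E \<in> sets M" unfolding E_def by measurable
  have [measurable]: "w \<in> borel_measurable M"
    using w(1) by (rule measurable_from_subalg[OF subalg])
  have [measurable]: "Z \<in> borel_measurable M" using Z by auto
  have [measurable]: "w \<in> borel_measurable ?F" by fact
  have [measurable]: "q \<in> borel_measurable M" "q \<in> borel_measurable ?F"
    by (auto simp: q_def cond_prob_rv_def cond_mean_def)
  have qb: "AE \<omega> in M. 0 \<le> q \<omega> \<and> q \<omega> \<le> 1"
    unfolding q_def using assms by (intro cond_prob_rv_bounds) auto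
  have wqb: "AE \<omega> in M. 0 \<le> w \<omega> * q \<omega> \<and> w \<omega> * q \<omega> \<le> K"
    using qb w(2)
  proof eventually_elim
    case (elim \<omega>)
    then have "w \<omega> * q \<omega> \<le> w \<omega> * 1" by (intro mult_left_mono) auto
    with elim show ?case by auto
  qed
  have w_int: "integrable M w"
    using w(2) by (intro integrable_const_bound[where B=K]) auto
  have wq_int: "integrable M (\<lambda>\<omega>. w \<omega> * q \<omega>)"
    using wqb by (intro integrable_const_bound[where B=K]) auto
  \<comment> \<open>Only the weight changes here: the indicator of \<open>E\<close> becomes its
    conditional probability \<open>q\<close>, while \<open>Z\<close> stays.\<close>
  have "(\<integral>\<omega>. (w \<omega> * indicator E \<omega>) * Z \<omega> \<partial>M) = (\<integral>\<omega>. (w \<omega> * q \<omega>) * Z \<omega> \<partial>M)"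
  proof (rule integral_weighted_cong)
    show "integrable M (\<lambda>\<omega>. w \<omega> * indicator E \<omega>)"
      using w_int by (intro integrable_real_mult_indicator) auto
    show "AE \<omega> in M. 0 \<le> w \<omega> * indicator E \<omega>"
      using w(2) by eventually_elim auto
    show "AE \<omega> in M. 0 \<le> w \<omega> * q \<omega>"
      using wqb by eventually_elim auto
    fix A :: "real set" assume [measurable]: "A \<in> sets borel"
    define G where "G = {\<omega> \<in> space M. Z \<omega> \<in> A}"
    have [measurable]: "G \<in> sets M" unfolding G_def by measurable
    have [measurable]: "cond_prob_rv M X H \<in> borel_measurable M" for H
      by (simp add: cond_prob_rv_def cond_mean_def)
    have GE: "{\<omega> \<in> space M. Z \<omega> \<in> A \<and> T \<omega> \<in> B} = G \<inter> E"
      by (auto simp: G_def E_def)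
    have "(\<integral>\<omega>. w \<omega> * indicator E \<omega> * indicator G \<omega> \<partial>M) = (\<integral>\<omega>. w \<omega> * indicator (G \<inter> E) \<omega> \<partial>M)"
      by (simp add: indicator_inter_arith ac_simps)
    also have "\<dots> = (\<integral>\<omega>. w \<omega> * cond_prob_rv M X (G \<inter> E) \<omega> \<partial>M)"
      using assms w_int by (intro integral_cond_prob_rv[symmetric]) auto
    also have "\<dots> = (\<integral>\<omega>. (w \<omega> * q \<omega>) * cond_prob_rv M X G \<omega> \<partial>M)"
    proof (rule integral_cong_AE)
      have "AE \<omega> in M. cond_prob_rv M X (G \<inter> E) \<omega> = cond_prob_rv M X G \<omega> * q \<omega>"
        using indep \<open>A \<in> sets borel\<close> B unfolding cond_indep_def q_def GE[symmetric]
        unfolding G_def E_def by blast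
      then show "AE \<omega> in M. w \<omega> * cond_prob_rv M X (G \<inter> E) \<omega> = (w \<omega> * q \<omega>) * cond_prob_rv M X G \<omega>"
        by eventually_elim simp
    qed measurable
    \<comment> \<open>Since \<open>w * q\<close> is again measurable with respect to
      \<open>X\<close>, it is a legitimate test function, and the conditional probability of
      \<open>G\<close> can be undone without touching \<open>q\<close>.\<close>
    also have "\<dots> = (\<integral>\<omega>. (w \<omega> * q \<omega>) * indicator G \<omega> \<partial>M)"
      using assms wq_int by (intro integral_cond_prob_rv) auto
    finally show "(\<integral>\<omega>. w \<omega> * indicator E \<omega> * indicator {\<omega> \<in> space M. Z \<omega> \<in> A} \<omega> \<partial>M) =
        (\<integral>\<omega>. w \<omega> * q \<omega> * indicator {\<omega> \<in> space M. Z \<omega> \<in> A} \<omega> \<partial>M)"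
      unfolding G_def .
  qed (use wq_int in auto)
  also have "\<dots> = (\<integral>\<omega>. (w \<omega> * q \<omega>) * cond_mean M X Z \<omega> \<partial>M)"
    unfolding cond_mean_def
  proof (rule real_cond_exp_intg(2)[symmetric])
    \<comment> \<open>The bounded factor \<open>w * q\<close> leaves the product dominated by
      \<open>K * Z\<close>, which is integrable because \<open>Z\<close> is.\<close>
    show "integrable M (\<lambda>\<omega>. w \<omega> * q \<omega> * Z \<omega>)"
    proof (rule Bochner_Integration.integrable_bound)
      show "integrable M (\<lambda>\<omega>. K * Z \<omega>)" using Z by simp
      show "AE \<omega> in M. norm (w \<omega> * q \<omega> * Z \<omega>) \<le> norm (K * Z \<omega>)"
        using wqb
      proof eventually_elim
        case (elim \<omega>)
        then have "\<bar>w \<omega> * q \<omega>\<bar> \<le> \<bar>K\<bar>" by linarith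
        then show ?case
          by (metis abs_ge_zero abs_mult mult_right_mono real_norm_def)
      qed
    qed measurable
  qed measurable
  finally show ?thesis unfolding q_def E_def .
qed

text \<open>Since \<open>w\<close> is at least 1, the integrand is at least \<eta> almost
  everywhere, and so is its integral over a probability space; \<open>K\<close> bounds it from above
  and gives integrability. This keeps the limits of the normalizing sums away from 0.\<close>

lemma integral_cond_prob_rv_pos:
  fixes w :: "'a \<Rightarrow> real"
  assumes "prob_space M" and X: "X \<in> borel_measurable M" and E: "E \<in> sets M"
    and w: "w \<in> borel_measurable (sigma_rv M X)" "AE \<omega> in M. 1 \<le> w \<omega> \<and> w \<omega> \<le> K"
    and \<eta>: "\<eta> > 0" "AE \<omega> in M. \<eta> < cond_prob_rv M X E \<omega>"
  shows "(\<integral>\<omega>. w \<omega> * cond_prob_rv M X E \<omega> \<partial>M) > 0"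
proof -
  interpret prob_space M by fact
  interpret sigma_finite_subalgebra M "sigma_rv M X"
    using assms by (intro sigma_finite_subalgebra_sigma_rv)
  have [measurable]: "w \<in> borel_measurable M"
    using w(1) by (rule measurable_from_subalg[OF subalg])
  have [measurable]: "cond_prob_rv M X E \<in> borel_measurable M"
    by (simp add: cond_prob_rv_def cond_mean_def)
  have "AE \<omega> in M. 0 \<le> cond_prob_rv M X E \<omega> \<and> cond_prob_rv M X E \<omega> \<le> 1"
    using assms by (intro cond_prob_rv_bounds)
  then have b: "AE \<omega> in M. \<eta> \<le> w \<omega> * cond_prob_rv M X E \<omega> \<and> w \<omega> * cond_prob_rv M X E \<omega> \<le> K"
    using w(2) \<eta>(2)
  proof eventually_elim
    case (elim \<omega>)
    have "1 * \<eta> \<le> w \<omega> * cond_prob_rv M X E \<omega>"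
      using elim \<eta>(1) by (intro mult_mono) auto
    moreover have "w \<omega> * cond_prob_rv M X E \<omega> \<le> K * 1"
      using elim by (intro mult_mono) auto
    ultimately show ?case by simp
  qed
  have "integrable M (\<lambda>\<omega>. w \<omega> * cond_prob_rv M X E \<omega>)"
    using b \<eta>(1) by (intro integrable_const_bound[where B=K]) auto
  then have "(\<integral>\<omega>. \<eta> \<partial>M) \<le> (\<integral>\<omega>. w \<omega> * cond_prob_rv M X E \<omega> \<partial>M)"
    using b by (intro integral_mono_AE) auto
  with \<eta>(1) show ?thesis by (simp add: prob_space)
qed


section \<open>Limit of the normalized weighting estimator\<close>

theorem theorem9:
  fixes M :: "'a measure"
    and X :: "'a \<Rightarrow> 'x::euclidean_space"
    and T Y Y1 Y0 :: "'a \<Rightarrow> real"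
    and Xs :: "nat \<Rightarrow> 'a \<Rightarrow> 'x"
    and Ts Ys :: "nat \<Rightarrow> 'a \<Rightarrow> real"
    and \<Theta> :: "'b::euclidean_space set"
    and emis :: "'x \<Rightarrow> 'b \<Rightarrow> real"
    and bhat :: "nat \<Rightarrow> 'a \<Rightarrow> 'b"
    and bstar :: 'b
    and c :: "nat \<Rightarrow> 'a \<Rightarrow> real"
    and \<eta> \<nu> :: real
  defines "W \<equiv> \<lambda>\<omega>. (T \<omega>, X \<omega>, Y \<omega>)"
    and "Ws \<equiv> \<lambda>i \<omega>. (Ts i \<omega>, Xs i \<omega>, Ys i \<omega>)"
    and "e \<equiv> propensity M T X"
    and "estar \<equiv> \<lambda>\<omega>. emis (X \<omega>) bstar"
    and "\<mu>1 \<equiv> integral\<^sup>L M Y1"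
    and "\<mu>0 \<equiv> integral\<^sup>L M Y0"
    and "\<mu>1X \<equiv> cond_mean M X Y1"
    and "\<mu>0X \<equiv> cond_mean M X Y0"
  assumes "prob_space M"
    and "X \<in> borel_measurable M"
    and "T \<in> borel_measurable M"
    and "\<And>\<omega>. \<omega> \<in> space M \<Longrightarrow> T \<omega> \<in> {0, 1}"
    and "integrable M Y1" and "integrable M Y0"
    and "\<And>\<omega>. \<omega> \<in> space M \<Longrightarrow> Y \<omega> = T \<omega> * Y1 \<omega> + (1 - T \<omega>) * Y0 \<omega>"
    and "iid_copies M Ws W"
    and "\<And>b. b \<in> \<Theta> \<Longrightarrow> (\<lambda>x. emis x b) \<in> borel_measurable borel"
    and "\<And>x b. b \<in> \<Theta> \<Longrightarrow> 0 < emis x b \<and> emis x b < 1"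
    and "bstar \<in> \<Theta>"
    and "is_estimator M Ws \<Theta> bhat"
    and "\<And>n. c n \<in> borel_measurable M"
    and i: "cond_indep M Y1 T X" "cond_indep M Y0 T X"
    and ii: "\<eta> > 0" "AE \<omega> in M. \<eta> < e \<omega> \<and> e \<omega> < 1 - \<eta>"
    and iii: "conv_in_prob M bhat bstar"
    and iv: "\<nu> > 0" "AE \<omega> in M. \<nu> < estar \<omega> \<and> estar \<omega> < 1 - \<nu>"
    and v: "wlln_estimated M Ws W bhat bstar (\<lambda>(t, x, y) b. t * y / emis x b)"
           "wlln_estimated M Ws W bhat bstar (\<lambda>(t, x, y) b. t / emis x b)"
           "wlln_estimated M Ws W bhat bstar (\<lambda>(t, x, y) b. (1 - t) * y / (1 - emis x b))"
           "wlln_estimated M Ws W bhat bstar (\<lambda>(t, x, y) b. (1 - t) / (1 - emis x b))"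
  shows "conv_in_prob M
    (\<lambda>n \<omega>. ipw2 emis (c n \<omega>) (bhat n \<omega>) n (\<lambda>i. Ts i \<omega>) (\<lambda>i. Xs i \<omega>) (\<lambda>i. Ys i \<omega>) - (\<mu>1 - \<mu>0))
    ((\<integral>\<omega>. e \<omega> / estar \<omega> * \<mu>1X \<omega> \<partial>M) / (\<integral>\<omega>. e \<omega> / estar \<omega> \<partial>M)
     - (\<integral>\<omega>. (1 - e \<omega>) / (1 - estar \<omega>) * \<mu>0X \<omega> \<partial>M) / (\<integral>\<omega>. (1 - e \<omega>) / (1 - estar \<omega>) \<partial>M)
     - (\<mu>1 - \<mu>0))"
proof -
  interpret prob_space M by fact
  let ?F = "sigma_rv M X"
  note X[measurable] = \<open>X \<in> borel_measurable M\<close>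
  note T[measurable] = \<open>T \<in> borel_measurable M\<close>
  note T01 = \<open>\<And>\<omega>. \<omega> \<in> space M \<Longrightarrow> T \<omega> \<in> {0, 1}\<close>
  note Yeq = \<open>\<And>\<omega>. \<omega> \<in> space M \<Longrightarrow> Y \<omega> = T \<omega> * Y1 \<omega> + (1 - T \<omega>) * Y0 \<omega>\<close>
  note emis_meas = \<open>\<And>b. b \<in> \<Theta> \<Longrightarrow> (\<lambda>x. emis x b) \<in> borel_measurable borel\<close>
  note emis01 = \<open>\<And>x b. b \<in> \<Theta> \<Longrightarrow> 0 < emis x b \<and> emis x b < 1\<close>
  note bstar = \<open>bstar \<in> \<Theta>\<close>
  note cm[measurable] = \<open>\<And>n. c n \<in> borel_measurable M\<close>
  interpret sigma_finite_subalgebra M ?F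
    using X by (intro sigma_finite_subalgebra_sigma_rv) unfold_locales

  \<comment> \<open>Treatment events, weights and propensity\<close>
  define E1 where "E1 = {\<omega> \<in> space M. T \<omega> \<in> {1}}"
  define E0 where "E0 = {\<omega> \<in> space M. T \<omega> \<in> {0}}"
  define w1 where "w1 = (\<lambda>\<omega>. 1 / estar \<omega>)"
  define w0 where "w0 = (\<lambda>\<omega>. 1 / (1 - estar \<omega>))"
  have [measurable]: "E1 \<in> sets M" "E0 \<in> sets M"
    unfolding E1_def E0_def by measurable
  have estar_F[measurable]: "estar \<in> borel_measurable ?F"
    unfolding estar_def using emis_meas[OF bstar] by (rule measurable_sigma_rv)
  have w1F: "w1 \<in> borel_measurable ?F" and w0F: "w0 \<in> borel_measurable ?F"
    unfolding w1_def w0_def by measurable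
  have estar01: "0 < estar \<omega>" "estar \<omega> < 1" for \<omega>
    using emis01[OF bstar] by (auto simp: estar_def)
  \<comment> \<open>The lower bound 1 comes from the working model taking values in (0,1), the upper
    bound \<open>1 / \<nu>\<close> from assumption (iv).\<close>
  have w1b: "AE \<omega> in M. 1 \<le> w1 \<omega> \<and> w1 \<omega> \<le> 1 / \<nu>" and w0b: "AE \<omega> in M. 1 \<le> w0 \<omega> \<and> w0 \<omega> \<le> 1 / \<nu>"
    using iv(2) by (eventually_elim; use estar01 \<open>\<nu> > 0\<close> in \<open>auto simp: w1_def w0_def field_simps\<close>)+
  have [measurable]: "w1 \<in> borel_measurable M" "w0 \<in> borel_measurable M"
    using w1F w0F measurable_from_subalg[OF subalg] by auto
  have w1i: "integrable M w1" and w0i: "integrable M w0"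
    using w1b w0b by (auto intro!: integrable_const_bound[where B="1 / \<nu>"])
  have [measurable]: "cond_mean M X Z \<in> borel_measurable M" for Z
    by (simp add: cond_mean_def)
  have [measurable]: "cond_prob_rv M X E \<in> borel_measurable M" for E
    by (simp add: cond_prob_rv_def)

  have [simp]: "integrable M (indicator E1 :: 'a \<Rightarrow> real)"
    by (simp add: integrable_indicator_iff emeasure_eq_measure)
  have e1: "cond_prob_rv M X E1 = e"
    by (simp add: e_def propensity_def E1_def)
  \<comment> \<open>A binary treatment makes the indicator of \<open>E0\<close> equal to one minus
    that of \<open>E1\<close>. Linearity of conditional expectation holds up to null sets, so this
    is an identity almost everywhere, unlike \<open>e1\<close>, where both sides are the same
    term.\<close>
  have e0: "AE \<omega> in M. cond_prob_rv M X E0 \<omega> = 1 - e \<omega>"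
  proof -
    have "indicator E0 \<omega> = 1 - (indicator E1 \<omega> :: real)" if "\<omega> \<in> space M" for \<omega>
      using T01[OF that] that by (auto simp: E0_def E1_def)
    then have "AE \<omega> in M. cond_prob_rv M X E0 \<omega> = real_cond_exp M ?F (\<lambda>\<omega>. 1 - indicator E1 \<omega>) \<omega>"
      unfolding cond_prob_rv_def cond_mean_def by (intro real_cond_exp_cong) auto
    moreover have "AE \<omega> in M. real_cond_exp M ?F (\<lambda>\<omega>. 1 - indicator E1 \<omega>) \<omega> =
        real_cond_exp M ?F (\<lambda>\<omega>. 1) \<omega> - real_cond_exp M ?F (indicator E1) \<omega>"
      by (intro real_cond_exp_diff) auto
    moreover have "AE \<omega> in M. real_cond_exp M ?F (\<lambda>\<omega>. 1) \<omega> = 1"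
      by (intro real_cond_exp_F_meas) auto
    ultimately show ?thesis
      unfolding e1[symmetric] cond_prob_rv_def cond_mean_def by eventually_elim simp
  qed
  have [measurable]: "e \<in> borel_measurable M"
    unfolding e1[symmetric] by measurable

  \<comment> \<open>Identification of the limiting expectations\<close>
  have num1: "(\<integral>\<omega>. T \<omega> * Y \<omega> / estar \<omega> \<partial>M) = (\<integral>\<omega>. e \<omega> / estar \<omega> * \<mu>1X \<omega> \<partial>M)"
  proof -
    \<comment> \<open>On \<open>E1\<close> the observed outcome is \<open>Y1\<close>, and off
      \<open>E1\<close> the factor \<open>T\<close> vanishes, so the observed outcome can be
      exchanged for the potential one.\<close>
    have "(\<integral>\<omega>. T \<omega> * Y \<omega> / estar \<omega> \<partial>M) = (\<integral>\<omega>. w1 \<omega> * indicator E1 \<omega> * Y1 \<omega> \<partial>M)"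
      using T01 Yeq by (intro Bochner_Integration.integral_cong) (auto simp: w1_def E1_def indicator_def)
    also have "\<dots> = (\<integral>\<omega>. w1 \<omega> * cond_prob_rv M X E1 \<omega> * cond_mean M X Y1 \<omega> \<partial>M)"
      unfolding E1_def
    proof (rule integral_weighted_cond_indep)
      show "AE \<omega> in M. 0 \<le> w1 \<omega> \<and> w1 \<omega> \<le> 1 / \<nu>" using w1b by eventually_elim auto
    qed (use assms w1F prob_space_axioms in auto)
    also have "\<dots> = (\<integral>\<omega>. e \<omega> / estar \<omega> * \<mu>1X \<omega> \<partial>M)"
      by (simp add: e1 w1_def \<mu>1X_def)
    finally show ?thesis .
  qed
  have num0: "(\<integral>\<omega>. (1 - T \<omega>) * Y \<omega> / (1 - estar \<omega>) \<partial>M) = (\<integral>\<omega>. (1 - e \<omega>) / (1 - estar \<omega>) * \<mu>0X \<omega> \<partial>M)"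
  proof -
    have "(\<integral>\<omega>. (1 - T \<omega>) * Y \<omega> / (1 - estar \<omega>) \<partial>M) = (\<integral>\<omega>. w0 \<omega> * indicator E0 \<omega> * Y0 \<omega> \<partial>M)"
      using T01 Yeq by (intro Bochner_Integration.integral_cong) (auto simp: w0_def E0_def indicator_def)
    also have "\<dots> = (\<integral>\<omega>. w0 \<omega> * cond_prob_rv M X E0 \<omega> * cond_mean M X Y0 \<omega> \<partial>M)"
      unfolding E0_def
    proof (rule integral_weighted_cond_indep)
      show "AE \<omega> in M. 0 \<le> w0 \<omega> \<and> w0 \<omega> \<le> 1 / \<nu>" using w0b by eventually_elim auto
    qed (use assms w0F prob_space_axioms in auto)
    also have "\<dots> = (\<integral>\<omega>. (1 - e \<omega>) / (1 - estar \<omega>) * \<mu>0X \<omega> \<partial>M)"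
    proof (rule integral_cong_AE)
      show "AE \<omega> in M. w0 \<omega> * cond_prob_rv M X E0 \<omega> * cond_mean M X Y0 \<omega> = (1 - e \<omega>) / (1 - estar \<omega>) * \<mu>0X \<omega>"
        using e0 by eventually_elim (simp add: w0_def \<mu>0X_def)
    qed (use measurable_from_subalg[OF subalg estar_F] in \<open>simp_all add: \<mu>0X_def\<close>)
    finally show ?thesis .
  qed
  \<comment> \<open>The weight depends on \<open>X\<close> alone, so conditioning replaces
    \<open>T\<close> by the propensity. Positivity is needed for continuity of the ratio at the
    limit.\<close>
  have den1: "(\<integral>\<omega>. T \<omega> / estar \<omega> \<partial>M) = (\<integral>\<omega>. e \<omega> / estar \<omega> \<partial>M)"
    and pos1: "(\<integral>\<omega>. e \<omega> / estar \<omega> \<partial>M) > 0"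
  proof -
    have eq: "(\<integral>\<omega>. w1 \<omega> * cond_prob_rv M X E1 \<omega> \<partial>M) = (\<integral>\<omega>. e \<omega> / estar \<omega> \<partial>M)"
      by (simp add: e1 w1_def)
    have "(\<integral>\<omega>. T \<omega> / estar \<omega> \<partial>M) = (\<integral>\<omega>. w1 \<omega> * indicator E1 \<omega> \<partial>M)"
      using T01 by (intro Bochner_Integration.integral_cong) (auto simp: w1_def E1_def indicator_def)
    then show "(\<integral>\<omega>. T \<omega> / estar \<omega> \<partial>M) = (\<integral>\<omega>. e \<omega> / estar \<omega> \<partial>M)"
      using integral_cond_prob_rv[OF prob_space_axioms X _ w1F w1i, of E1] eq by simp
    have "AE \<omega> in M. \<eta> < cond_prob_rv M X E1 \<omega>"
      using ii(2) unfolding e1 by eventually_elim auto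
    then show "(\<integral>\<omega>. e \<omega> / estar \<omega> \<partial>M) > 0"
      using integral_cond_prob_rv_pos[OF prob_space_axioms X _ w1F w1b \<open>\<eta> > 0\<close>, of E1] eq by simp
  qed
  have den0: "(\<integral>\<omega>. (1 - T \<omega>) / (1 - estar \<omega>) \<partial>M) = (\<integral>\<omega>. (1 - e \<omega>) / (1 - estar \<omega>) \<partial>M)"
    and pos0: "(\<integral>\<omega>. (1 - e \<omega>) / (1 - estar \<omega>) \<partial>M) > 0"
  proof -
    have eq: "(\<integral>\<omega>. w0 \<omega> * cond_prob_rv M X E0 \<omega> \<partial>M) = (\<integral>\<omega>. (1 - e \<omega>) / (1 - estar \<omega>) \<partial>M)"
    proof (rule integral_cong_AE)
      show "AE \<omega> in M. w0 \<omega> * cond_prob_rv M X E0 \<omega> = (1 - e \<omega>) / (1 - estar \<omega>)"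
        using e0 by eventually_elim (simp add: w0_def)
    qed (use measurable_from_subalg[OF subalg estar_F] in simp_all)
    have "(\<integral>\<omega>. (1 - T \<omega>) / (1 - estar \<omega>) \<partial>M) = (\<integral>\<omega>. w0 \<omega> * indicator E0 \<omega> \<partial>M)"
      using T01 by (intro Bochner_Integration.integral_cong) (auto simp: w0_def E0_def indicator_def)
    then show "(\<integral>\<omega>. (1 - T \<omega>) / (1 - estar \<omega>) \<partial>M) = (\<integral>\<omega>. (1 - e \<omega>) / (1 - estar \<omega>) \<partial>M)"
      using integral_cond_prob_rv[OF prob_space_axioms X _ w0F w0i, of E0] eq by simp
    \<comment> \<open>The upper half of the overlap condition (ii) is the lower bound for the
      control group.\<close>
    have "AE \<omega> in M. \<eta> < cond_prob_rv M X E0 \<omega>"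
      using ii(2) e0 by eventually_elim auto
    then show "(\<integral>\<omega>. (1 - e \<omega>) / (1 - estar \<omega>) \<partial>M) > 0"
      using integral_cond_prob_rv_pos[OF prob_space_axioms X _ w0F w0b \<open>\<eta> > 0\<close>, of E0] eq by simp
  qed

  \<comment> \<open>Convergence and measurability of the sample sums\<close>
  define N1 where "N1 = (\<lambda>n \<omega>. \<Sum>i=1..n. Ts i \<omega> * Ys i \<omega> / emis (Xs i \<omega>) (bhat n \<omega>))"
  define S1 where "S1 = (\<lambda>n \<omega>. \<Sum>i=1..n. Ts i \<omega> / emis (Xs i \<omega>) (bhat n \<omega>))"
  define N0 where "N0 = (\<lambda>n \<omega>. \<Sum>i=1..n. (1 - Ts i \<omega>) * Ys i \<omega> / (1 - emis (Xs i \<omega>) (bhat n \<omega>)))"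
  define S0 where "S0 = (\<lambda>n \<omega>. \<Sum>i=1..n. (1 - Ts i \<omega>) / (1 - emis (Xs i \<omega>) (bhat n \<omega>)))"
  have lim: "conv_in_prob M (\<lambda>n \<omega>. 1 / real n * N1 n \<omega>) (\<integral>\<omega>. e \<omega> / estar \<omega> * \<mu>1X \<omega> \<partial>M)"
    "conv_in_prob M (\<lambda>n \<omega>. 1 / real n * S1 n \<omega>) (\<integral>\<omega>. e \<omega> / estar \<omega> \<partial>M)"
    "conv_in_prob M (\<lambda>n \<omega>. 1 / real n * N0 n \<omega>) (\<integral>\<omega>. (1 - e \<omega>) / (1 - estar \<omega>) * \<mu>0X \<omega> \<partial>M)"
    "conv_in_prob M (\<lambda>n \<omega>. 1 / real n * S0 n \<omega>) (\<integral>\<omega>. (1 - e \<omega>) / (1 - estar \<omega>) \<partial>M)"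
    \<comment> \<open>The limits are rewritten backwards into expectations of \<open>T\<close>,
      \<open>Y\<close> and \<open>estar\<close>, the form in which assumption (v) delivers
      them.\<close>
    unfolding num1[symmetric] num0[symmetric] den1[symmetric] den0[symmetric]
    using v unfolding wlln_estimated_def W_def Ws_def prod.case N1_def S1_def N0_def S0_def estar_def
    by blast+
  \<comment> \<open>Measurability of the averages is part of \<open>conv_in_prob\<close>, and
    multiplying by \<open>n\<close> recovers the sums. For \<open>n = 0\<close> the factor
    \<open>1 / real n\<close> is 0 and says nothing about the sum, but the empty sum is
    constant.\<close>
  have sum_meas: "V n \<in> borel_measurable M"
    if "conv_in_prob M (\<lambda>n \<omega>. 1 / real n * V n \<omega>) l" "V 0 = (\<lambda>_. 0)"
    for V :: "nat \<Rightarrow> 'a \<Rightarrow> real" and l n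
  proof (cases "n = 0")
    case False
    have "(\<lambda>\<omega>. 1 / real n * V n \<omega>) \<in> borel_measurable M"
      using that(1) by (simp add: conv_in_prob_def)
    then have "(\<lambda>\<omega>. real n * (1 / real n * V n \<omega>)) \<in> borel_measurable M"
      by measurable
    with False show ?thesis by simp
  qed (simp add: that(2))
  have [measurable]: "N1 n \<in> borel_measurable M" "S1 n \<in> borel_measurable M"
    "N0 n \<in> borel_measurable M" "S0 n \<in> borel_measurable M" for n
    by (rule lim[THEN sum_meas]; simp add: N1_def S1_def N0_def S0_def)+

  \<comment> \<open>Continuous mapping for the difference of ratios\<close>
  let ?a = "\<integral>\<omega>. e \<omega> / estar \<omega> * \<mu>1X \<omega> \<partial>M" and ?b = "\<integral>\<omega>. e \<omega> / estar \<omega> \<partial>M"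
  let ?c = "\<integral>\<omega>. (1 - e \<omega>) / (1 - estar \<omega>) * \<mu>0X \<omega> \<partial>M" and ?d = "\<integral>\<omega>. (1 - e \<omega>) / (1 - estar \<omega>) \<partial>M"
  define f :: "(real \<times> real) \<times> (real \<times> real) \<Rightarrow> real" where
    "f = (\<lambda>p. fst (fst p) / snd (fst p) - fst (snd p) / snd (snd p) - (\<mu>1 - \<mu>0))"
  \<comment> \<open>\<open>D\<close> requires both normalizing averages to be nonzero. It is open
    and contains the limit by \<open>pos1\<close> and \<open>pos0\<close>; for positive
    \<open>n\<close> it excludes exactly the outcomes on which the estimator takes the arbitrary
    value \<open>c\<close>.\<close>
  define D :: "((real \<times> real) \<times> (real \<times> real)) set" where
    "D = (UNIV \<times> (- {0})) \<times> (UNIV \<times> (- {0}))"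
  have ipw2_eq: "ipw2 emis (c n \<omega>) (bhat n \<omega>) n (\<lambda>i. Ts i \<omega>) (\<lambda>i. Xs i \<omega>) (\<lambda>i. Ys i \<omega>) =
      (if S1 n \<omega> = 0 \<or> S0 n \<omega> = 0 then c n \<omega>
       else inverse (S1 n \<omega>) * N1 n \<omega> - inverse (S0 n \<omega>) * N0 n \<omega>)" for n \<omega>
    by (simp add: ipw2_def Let_def S1_def S0_def N1_def N0_def)
  have "conv_in_prob M
    (\<lambda>n \<omega>. ipw2 emis (c n \<omega>) (bhat n \<omega>) n (\<lambda>i. Ts i \<omega>) (\<lambda>i. Xs i \<omega>) (\<lambda>i. Ys i \<omega>) - (\<mu>1 - \<mu>0))
    (f ((?a, ?b), (?c, ?d)))"
  proof (rule conv_in_prob_continuous[OF prob_space_axioms, where f=f and D=D])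
    show "conv_in_prob M (\<lambda>n \<omega>. ((1 / real n * N1 n \<omega>, 1 / real n * S1 n \<omega>),
        (1 / real n * N0 n \<omega>, 1 / real n * S0 n \<omega>))) ((?a, ?b), (?c, ?d))"
      by (intro conv_in_prob_Pair prob_space_axioms lim)
    show "isCont f ((?a, ?b), (?c, ?d))"
      unfolding f_def using pos1 pos0 by (intro continuous_intros) auto
    show "open D"
      unfolding D_def by (intro open_Times) auto
    show "((?a, ?b), (?c, ?d)) \<in> D"
      unfolding D_def using pos1 pos0 by auto
    show "(\<lambda>\<omega>. ipw2 emis (c n \<omega>) (bhat n \<omega>) n (\<lambda>i. Ts i \<omega>) (\<lambda>i. Xs i \<omega>) (\<lambda>i. Ys i \<omega>) - (\<mu>1 - \<mu>0))
        \<in> borel_measurable M" for n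
      unfolding ipw2_eq by measurable
    show "eventually (\<lambda>n. \<forall>\<omega>\<in>space M. ((1 / real n * N1 n \<omega>, 1 / real n * S1 n \<omega>),
          (1 / real n * N0 n \<omega>, 1 / real n * S0 n \<omega>)) \<in> D \<longrightarrow>
        ipw2 emis (c n \<omega>) (bhat n \<omega>) n (\<lambda>i. Ts i \<omega>) (\<lambda>i. Xs i \<omega>) (\<lambda>i. Ys i \<omega>) - (\<mu>1 - \<mu>0) =
        f ((1 / real n * N1 n \<omega>, 1 / real n * S1 n \<omega>), (1 / real n * N0 n \<omega>, 1 / real n * S0 n \<omega>)))
      sequentially"
      \<comment> \<open>For \<open>n > 0\<close> the factor \<open>1 / n\<close> cancels in both
        ratios, and a nonzero average means a nonzero sum.\<close>
      using eventually_gt_at_top[of 0]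
      by eventually_elim (auto simp: D_def f_def ipw2_eq field_simps)
  qed
  then show ?thesis by (simp add: f_def)
qed

end
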